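(* Let $E,F:(0,\infty)\to\mathbb{R}$ be functions such that for all $t,s\in(0,\infty)$, $t\le s$ implies $E(t)<F(s)$. Suppose that at least one of the following holds: (i) $F$ is nondecreasing, and for every $t>0$ and every sequence $(t_n)$ with $t_n>t$ for all $n$ and $t_n\to t$, one has $\liminf_{n\to\infty}E(t_n)<F(t)$; or (ii) $F$ is continuous on the right at every point of $(0,\infty)$, and for every $t>0$ and every sequence $(t_n)$ with $t_n\ge t$ for all $n$ and $t_n\to t$, one has $\liminf_{n\to\infty}E(t_n)<F(t)$. If $(X,d)$ is a complete metric space and $T:X\to X$ is an $(E,F)$-contraction, then $T$ is a Meir-Keeler contraction.
   Context: Let $(X,d)$ be a metric space, $T:X\to X$ a mapping, and $E,F:(0,\infty)\to\mathbb{R}$ functions such that for all $t,s\in(0,\infty)$, $t\le s$ implies $E(t)<F(s)$. $T$ is called an $(E,F)$-contraction if for all $x,y\in X$ with $Tx\neq Ty$, $F(d(Tx,Ty))\le E(d(x,y))$. $T$ is called a Meir-Keeler contraction if for every $\varepsilon>0$ there exists $\delta>0$ such that for all $x,y\in X$: $\varepsilon\le d(x,y)<\varepsilon+\delta$ implies $d(Tx,Ty)<\varepsilon$. The $\liminf$ is taken in the extended real line $[-\infty,+\infty]$. *)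

theory Defs
  imports "HOL-Analysis.Analysis"
begin

text \<open>Functions on \<open>(0, \<infinity>)\<close> are rendered as functions on \<^typ>\<open>real\<close> whose values outside
  \<^term>\<open>{0<..} :: real set\<close> are never used.\<close>

definition EF_contraction_on ::
    "'a set \<Rightarrow> ('a \<Rightarrow> 'a \<Rightarrow> real) \<Rightarrow> (real \<Rightarrow> real) \<Rightarrow> (real \<Rightarrow> real) \<Rightarrow> ('a \<Rightarrow> 'a) \<Rightarrow> bool" where
  "EF_contraction_on X d E F T \<longleftrightarrow>
     (\<forall>x\<in>X. \<forall>y\<in>X. T x \<noteq> T y \<longrightarrow> F (d (T x) (T y)) \<le> E (d x y))"

definition Meir_Keeler_contraction_on ::
    "'a set \<Rightarrow> ('a \<Rightarrow> 'a \<Rightarrow> real) \<Rightarrow> ('a \<Rightarrow> 'a) \<Rightarrow> bool" where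
  "Meir_Keeler_contraction_on X d T \<longleftrightarrow>
     (\<forall>\<epsilon>>0. \<exists>\<delta>>0. \<forall>x\<in>X. \<forall>y\<in>X. \<epsilon> \<le> d x y \<and> d x y < \<epsilon> + \<delta> \<longrightarrow> d (T x) (T y) < \<epsilon>)"

end

theory Submission imports Defs begin

text \<open>
  If \<open>T\<close> is not a Meir-Keeler contraction, some \<open>\<epsilon> > 0\<close> admits pairs of points whose distances
  \<open>u n\<close> tend to \<open>\<epsilon>\<close> from the right while the distances \<open>v n\<close> of their images stay at least
  \<open>\<epsilon>\<close> (\<open>not_Meir_Keeler_sequences\<close>). The images are distinct because \<open>v n > 0\<close>, so the
  contraction inequality reads \<open>F (v n) \<le> E (u n)\<close>. Since \<open>E t < F s\<close> whenever \<open>t \<le> s\<close>, this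
  forces \<open>v n < u n\<close>: the sequence \<open>u\<close> lies strictly above \<open>\<epsilon>\<close>, and \<open>v\<close> is squeezed towards
  \<open>\<epsilon>\<close>. Either regularity hypothesis on \<open>F\<close> (monotonicity or right continuity) now turns
  \<open>F (v n) \<le> E (u n)\<close> into \<open>F \<epsilon> \<le> liminf E (u n)\<close>, against the assumption on \<open>E\<close>.
\<close>

lemma not_Meir_Keeler_sequences:
  assumes "\<not> Meir_Keeler_contraction_on X d T"
  obtains \<epsilon> x y where "0 < \<epsilon>" "\<And>n::nat. x n \<in> X" "\<And>n. y n \<in> X"
    "\<And>n. \<epsilon> \<le> d (x n) (y n)" "\<And>n. \<epsilon> \<le> d (T (x n)) (T (y n))"
    "(\<lambda>n. d (x n) (y n)) \<longlonglongrightarrow> \<epsilon>"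
proof -
  obtain \<epsilon> where "0 < \<epsilon>" and fail: "\<And>\<delta>. 0 < \<delta> \<Longrightarrow> \<exists>x\<in>X. \<exists>y\<in>X. \<epsilon> \<le> d x y \<and> d x y < \<epsilon> + \<delta> \<and> \<epsilon> \<le> d (T x) (T y)"
    using assms unfolding Meir_Keeler_contraction_on_def by (meson not_less)
  have "\<forall>n::nat. \<exists>x y. x \<in> X \<and> y \<in> X \<and> \<epsilon> \<le> d x y \<and> d x y < \<epsilon> + 1 / real (Suc n) \<and> \<epsilon> \<le> d (T x) (T y)"
    using fail by (metis of_nat_0_less_iff zero_less_Suc zero_less_divide_1_iff)
  then obtain x y where xy: "\<And>n::nat. x n \<in> X \<and> y n \<in> X \<and> \<epsilon> \<le> d (x n) (y n) \<and>
      d (x n) (y n) < \<epsilon> + 1 / real (Suc n) \<and> \<epsilon> \<le> d (T (x n)) (T (y n))"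
    by metis
  have upper: "(\<lambda>n. \<epsilon> + 1 / real (Suc n)) \<longlonglongrightarrow> \<epsilon>"
    using tendsto_add[OF tendsto_const LIMSEQ_inverse_real_of_nat, of \<epsilon>]
    by (simp add: inverse_eq_divide)
  have "(\<lambda>n. d (x n) (y n)) \<longlonglongrightarrow> \<epsilon>"
    by (rule tendsto_sandwich[OF _ _ tendsto_const upper]) (use xy in \<open>auto intro!: always_eventually less_imp_le\<close>)
  with that \<open>0 < \<epsilon>\<close> xy show thesis by blast
qed

lemma continuous_at_right_sequentially:
  fixes f :: "real \<Rightarrow> real"
  assumes "continuous (at_right a) f" "\<And>n::nat. a \<le> v n" "v \<longlonglongrightarrow> a"
  shows "(\<lambda>n. f (v n)) \<longlonglongrightarrow> f a"
proof -
  \<comment> \<open>The punctured filter ignores \<open>a\<close> itself, so adjoining \<open>a\<close> admits sequences that attain it.\<close>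
  have "{a..} - {a} = {a<..} - {a}" by auto
  then have "at_right a = at a within {a..}"
    by (simp add: at_within_def)
  with assms show ?thesis
    by (auto simp: continuous_within_sequentially o_def)
qed

theorem theorem14:
  fixes X :: "'a set" and d :: "'a \<Rightarrow> 'a \<Rightarrow> real" and T :: "'a \<Rightarrow> 'a"
    and E F :: "real \<Rightarrow> real"
  assumes EF: "\<And>t s. 0 < t \<Longrightarrow> 0 < s \<Longrightarrow> t \<le> s \<Longrightarrow> E t < F s"
    and cases:
      "(mono_on {0<..} F \<and>
        (\<forall>t>0. \<forall>u :: nat \<Rightarrow> real. (\<forall>n. t < u n) \<and> u \<longlonglongrightarrow> t \<longrightarrow>
           liminf (\<lambda>n. ereal (E (u n))) < ereal (F t)))
       \<or>
       ((\<forall>t>0. continuous (at_right t) F) \<and>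
        (\<forall>t>0. \<forall>u :: nat \<Rightarrow> real. (\<forall>n. t \<le> u n) \<and> u \<longlonglongrightarrow> t \<longrightarrow>
           liminf (\<lambda>n. ereal (E (u n))) < ereal (F t)))"
    and metric: "Metric_space X d"
    and complete: "Metric_space.mcomplete X d"
    and maps: "T \<in> X \<rightarrow> X"
    and contr: "EF_contraction_on X d E F T"
  shows "Meir_Keeler_contraction_on X d T"
proof (rule ccontr)
  assume "\<not> Meir_Keeler_contraction_on X d T"
  then obtain \<epsilon> x y where "0 < \<epsilon>" and inX: "\<And>n::nat. x n \<in> X" "\<And>n. y n \<in> X"
    and ge: "\<And>n. \<epsilon> \<le> d (x n) (y n)" "\<And>n. \<epsilon> \<le> d (T (x n)) (T (y n))"
    and lim: "(\<lambda>n. d (x n) (y n)) \<longlonglongrightarrow> \<epsilon>"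
    by (rule not_Meir_Keeler_sequences) blast
  define u v where "u = (\<lambda>n. d (x n) (y n))" and "v = (\<lambda>n. d (T (x n)) (T (y n)))"
  have u_lim: "u \<longlonglongrightarrow> \<epsilon>" and v_ge: "\<epsilon> \<le> v n" and u_ge: "\<epsilon> \<le> u n" for n
    using lim ge by (auto simp: u_def v_def)
  have "T (x n) \<noteq> T (y n)" for n
  proof
    assume "T (x n) = T (y n)"
    moreover have "T (x n) \<in> X" using maps inX by blast
    ultimately have "d (T (x n)) (T (y n)) = 0"
      using Metric_space.mdist_zero[OF metric] by simp
    with ge(2)[of n] \<open>0 < \<epsilon>\<close> show False by simp
  qed
  then have FE: "F (v n) \<le> E (u n)" for n
    using contr inX unfolding EF_contraction_on_def u_def v_def by blast
  have less: "v n < u n" for n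
    using EF[of "u n" "v n"] FE[of n] u_ge[of n] v_ge[of n] \<open>0 < \<epsilon>\<close> by fastforce
  then have u_gt: "\<epsilon> < u n" for n
    using v_ge[of n] by (rule le_less_trans[rotated])
  have v_lim: "v \<longlonglongrightarrow> \<epsilon>"
    by (rule tendsto_sandwich[OF _ _ tendsto_const u_lim])
      (use less v_ge in \<open>auto intro!: always_eventually less_imp_le\<close>)
  have liminf_less: "liminf (\<lambda>n. ereal (E (u n))) < ereal (F \<epsilon>)"
    using cases u_gt u_ge u_lim \<open>0 < \<epsilon>\<close> by blast
  have "ereal (F \<epsilon>) \<le> liminf (\<lambda>n. ereal (F (v n)))"
    using cases
  proof (elim disjE conjE)
    assume mono: "mono_on {0<..} F"
    have "F \<epsilon> \<le> F (v n)" for n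
      using mono_onD[OF mono, of \<epsilon> "v n"] v_ge[of n] \<open>0 < \<epsilon>\<close> by simp
    then show ?thesis by (intro Liminf_bounded) simp
  next
    assume "\<forall>t>0. continuous (at_right t) F"
    then have "(\<lambda>n. F (v n)) \<longlonglongrightarrow> F \<epsilon>"
      using continuous_at_right_sequentially v_ge v_lim \<open>0 < \<epsilon>\<close> by blast
    then have "liminf (\<lambda>n. ereal (F (v n))) = ereal (F \<epsilon>)"
      by (intro lim_imp_Liminf) simp_all
    then show ?thesis by simp
  qed
  also have "\<dots> \<le> liminf (\<lambda>n. ereal (E (u n)))"
    using FE by (intro Liminf_mono) simp
  finally show False using liminf_less by simp
qed

end
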